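(* $43\le R_{C_4}(4,4,4,4)\le R(3,3,3,3)+1$.
   Context: $C_4\le S_4$ denotes the cyclic group generated by $(1\,2\,3\,4)$. A $4$-edge-coloured complete graph is a complete graph with each edge coloured from $\{1,2,3,4\}$. For $\pi\in C_4$ and a vertex $v$, switching at $v$ with $\pi$ recolours every edge incident with $v$ of colour $i$ to colour $\pi(i)$, leaving other edges unchanged. Two such graphs on the same vertex set are $C_4$-switch equivalent if one is obtained from the other by a finite sequence of switches. $K_t^{(i)}$ is a complete graph on $t$ vertices with all edges of colour $i$. $R_{C_4}(a_1,a_2,a_3,a_4)$ is the least $n$ such that every $4$-edge-coloured complete graph on $n$ vertices is $C_4$-switch equivalent to one containing, for some $i$, a copy of $K_{a_i}^{(i)}$. $R(3,3,3,3)$ is the classical $4$-colour Ramsey number for triangles. *)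

theory Defs
  imports "HOL-Algebra.Sym_Groups" "HOL-Library.Ramsey"
begin

definition C4 :: "(nat \<Rightarrow> nat) set"
  where "C4 = generate (sym_group 4) {cycle_of_list [1, 2, 3, 4]}"

(* A complete graph on the vertex set V has edge set nsets V 2. Extensionality makes
   equality of colourings the same as equality of coloured graphs. *)
definition edge_colourings :: "'v set \<Rightarrow> ('v set \<Rightarrow> nat) set"
  where "edge_colourings V = nsets V 2 \<rightarrow>\<^sub>E {1..4}"

definition switch :: "'v set \<Rightarrow> 'v \<Rightarrow> (nat \<Rightarrow> nat) \<Rightarrow> ('v set \<Rightarrow> nat) \<Rightarrow> 'v set \<Rightarrow> nat"
  where "switch V v \<pi> c = (\<lambda>e. if e \<in> nsets V 2 \<and> v \<in> e then \<pi> (c e) else c e)"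

definition C4_switch_step :: "'v set \<Rightarrow> ('v set \<Rightarrow> nat) \<Rightarrow> ('v set \<Rightarrow> nat) \<Rightarrow> bool"
  where "C4_switch_step V c c' \<longleftrightarrow> (\<exists>v\<in>V. \<exists>\<pi>\<in>C4. c' = switch V v \<pi> c)"

definition C4_switch_equivalent :: "'v set \<Rightarrow> ('v set \<Rightarrow> nat) \<Rightarrow> ('v set \<Rightarrow> nat) \<Rightarrow> bool"
  where "C4_switch_equivalent V = (C4_switch_step V)\<^sup>*\<^sup>*"

(* The clique size for colour i is the entry of as at position i - 1, since colours start at 1. *)
definition C4_arrows :: "nat \<Rightarrow> nat list \<Rightarrow> bool"
  where "C4_arrows n as \<longleftrightarrow>
    (\<forall>c\<in>edge_colourings {..<n}. \<exists>c'. C4_switch_equivalent {..<n} c c' \<and>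
       (\<exists>i\<in>{1..4}. monochromatic {..<n} (as ! (i - 1)) 2 c' i))"

definition C4_ramsey_number :: "nat list \<Rightarrow> nat"
  where "C4_ramsey_number as = (LEAST n. C4_arrows n as)"

(* The number of colours is length as; the library numbers them from 0. *)
definition ramsey_number :: "nat list \<Rightarrow> nat"
  where "ramsey_number as = (LEAST n. partn_lst {..<n} as 2)"

(* Both minima range over non-empty sets. *)

lemma ex_partn_lst: "\<exists>n. partn_lst {..<n::nat} as 2"
  using ramsey_full by blast

lemma ex_C4_arrows:
  assumes "length as = 4"
  shows "\<exists>n. C4_arrows n as"
proof -
  obtain n where n: "partn_lst {..<n::nat} as 2"
    using ex_partn_lst by blast
  have "\<exists>i\<in>{1..4}. monochromatic {..<n} (as ! (i - 1)) 2 c i"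
    if c: "c \<in> edge_colourings {..<n}" for c
  proof -
    have range: "c e \<in> {1..4}" if "e \<in> nsets {..<n} 2" for e
      using c that unfolding edge_colourings_def by blast
    have "(\<lambda>e. c e - 1) \<in> nsets {..<n} 2 \<rightarrow> {..<length as}"
      using range assms by fastforce
    then obtain j where j: "j < 4" "monochromatic {..<n} (as ! j) 2 (\<lambda>e. c e - 1) j"
      using n assms unfolding partn_lst_def by metis
    then obtain H where H: "H \<in> nsets {..<n} (as ! j)" "(\<lambda>e. c e - 1) ` nsets H 2 \<subseteq> {j}"
      unfolding monochromatic_def by blast
    have "c e = Suc j" if "e \<in> nsets H 2" for e
    proof -
      have "e \<in> nsets {..<n} 2"
        using that H(1) by (auto simp: nsets_def)
      moreover have "c e - 1 = j"
        using H(2) that by blast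
      ultimately show ?thesis
        using range[of e] by auto
    qed
    then have "monochromatic {..<n} (as ! (Suc j - 1)) 2 c (Suc j)"
      using H(1) unfolding monochromatic_def by auto
    then show ?thesis
      using j(1) by (intro bexI[of _ "Suc j"]) auto
  qed
  then show ?thesis
    unfolding C4_arrows_def C4_switch_equivalent_def by blast
qed

end

theory Submission
  imports Defs "HOL-Number_Theory.Cong"
begin

text \<open>
  Lower bound: colour the complete graph on the projective line over \<open>F\<^sub>4\<^sub>1\<close> (42 points) by the
  quartic character of the bracket of two points. Switching changes the colour of \<open>uv\<close> by
  \<open>k u + k v\<close> modulo 4, so a 4-set that can be made monochromatic has equal colour sums, modulo 4,
  on its three perfect matchings. The Pluecker relation then yields \<open>x\<close>, \<open>z\<close> and \<open>x + z\<close> with the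
  same non-zero quartic character, hence, after scaling, two consecutive quartic residues
  modulo 41; there are none.

  Upper bound: switch the neighbours of a vertex \<open>n\<close> until the star at \<open>n\<close> has a single colour,
  find a monochromatic clique among the other vertices, and switch at \<open>n\<close> to give the star
  the colour of that clique.
\<close>

section \<open>The group \<open>C4\<close> as the shifts of the colours modulo 4\<close>

lemma cycle4_simps:
  "cycle_of_list [1, 2, 3, 4 :: nat] 1 = 2" "cycle_of_list [1, 2, 3, 4 :: nat] 2 = 3"
  "cycle_of_list [1, 2, 3, 4 :: nat] 3 = 4" "cycle_of_list [1, 2, 3, 4 :: nat] 4 = 1"
  by (simp_all add: transpose_def)

lemma cycle4_in_carrier: "cycle_of_list [1, 2, 3, 4] \<in> carrier (sym_group 4)"
proof -
  have "cycle_of_list [1, 2, 3, 4 :: nat] permutes set [1, 2, 3, 4]"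
    by (rule cycle_permutes)
  moreover have "set [1, 2, 3, 4 :: nat] = {1..4}"
    by auto
  ultimately show ?thesis
    by (simp only: sym_group_carrier)
qed

text \<open>Colour 4 stands for residue 0. Only 1 to 4 are constrained, since elements of
  \<open>sym_group 4\<close> fix everything else.\<close>

definition shift_mod4 :: "nat \<Rightarrow> (nat \<Rightarrow> nat) \<Rightarrow> bool"
  where "shift_mod4 k \<pi> \<longleftrightarrow> (\<forall>i\<in>{1..4}. \<pi> i \<in> {1..4} \<and> [\<pi> i = i + k] (mod 4))"

text \<open>The generator shifts by 1 and its inverse by 3; composition adds shifts.\<close>

lemma C4_shift:
  assumes "\<pi> \<in> C4"
  obtains k where "shift_mod4 k \<pi>"
proof -
  define \<sigma> where "\<sigma> = cycle_of_list [1, 2, 3, 4 :: nat]"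
  have simps: "\<sigma> 1 = 2" "\<sigma> 2 = 3" "\<sigma> 3 = 4" "\<sigma> 4 = 1"
    unfolding \<sigma>_def by (fact cycle4_simps)+
  have carrier: "\<sigma> \<in> carrier (sym_group 4)"
    unfolding \<sigma>_def by (fact cycle4_in_carrier)
  have set4: "{1..4} = {1, 2, 3, 4 :: nat}"
    by auto
  have "\<exists>k. shift_mod4 k \<pi>"
    using assms unfolding C4_def \<sigma>_def[symmetric]
  proof (induction rule: generate.induct)
    case one
    have "shift_mod4 0 id"
      by (simp add: shift_mod4_def)
    then show ?case
      unfolding sym_group_one ..
  next
    case (incl h)
    then have "shift_mod4 1 h"
      unfolding shift_mod4_def set4 by (simp add: simps simps(1)[simplified] cong_def)
    then show ?case ..
  next
    case (inv h)
    then have h: "inv\<^bsub>sym_group 4\<^esub> h = inv' \<sigma>"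
      using sym_group_inv_equality[OF carrier] by simp
    have "inj \<sigma>"
      using carrier permutes_inj unfolding sym_group_carrier by blast
    then have "inv' \<sigma> 2 = 1" "inv' \<sigma> 3 = 2" "inv' \<sigma> 4 = 3" "inv' \<sigma> 1 = 4"
      using simps by (metis inv_f_f)+
    then have "shift_mod4 3 (inv' \<sigma>)"
      unfolding shift_mod4_def set4 by (simp add: cong_def)
    then show ?case
      unfolding h ..
  next
    case (eng h1 h2)
    then obtain k1 k2 where k: "shift_mod4 k1 h1" "shift_mod4 k2 h2"
      by blast
    have "shift_mod4 (k2 + k1) (h1 \<circ> h2)"
      unfolding shift_mod4_def
    proof (intro ballI conjI)
      fix i :: nat
      assume "i \<in> {1..4}"
      then have h2: "h2 i \<in> {1..4}" "[h2 i = i + k2] (mod 4)"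
        using k(2) by (auto simp: shift_mod4_def)
      then have h1: "h1 (h2 i) \<in> {1..4}" "[h1 (h2 i) = h2 i + k1] (mod 4)"
        using k(1) by (auto simp: shift_mod4_def)
      show "(h1 \<circ> h2) i \<in> {1..4}"
        using h1(1) by simp
      have "[h2 i + k1 = i + k2 + k1] (mod 4)"
        using h2(2) by (intro cong_add) auto
      with h1(2) show "[(h1 \<circ> h2) i = i + (k2 + k1)] (mod 4)"
        by (metis cong_trans add.assoc comp_apply)
    qed
    then show ?case
      unfolding sym_group_mult ..
  qed
  then show thesis
    using that by blast
qed

text \<open>The four powers of the 4-cycle carry any one colour to all four colours.\<close>

lemma C4_transitive:
  assumes "i \<in> {1..4}" "j \<in> {1..4}"
  obtains \<pi> where "\<pi> \<in> C4" "\<pi> i = j"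
proof -
  define \<sigma> where "\<sigma> = cycle_of_list [1, 2, 3, 4 :: nat]"
  have simps: "\<sigma> 1 = 2" "\<sigma> 2 = 3" "\<sigma> 3 = 4" "\<sigma> 4 = 1"
    unfolding \<sigma>_def by (fact cycle4_simps)+
  have id: "id \<in> C4"
    unfolding C4_def using generate.one[of "sym_group 4"] by (simp add: sym_group_one)
  have comp: "\<sigma> \<circ> \<pi> \<in> C4" if "\<pi> \<in> C4" for \<pi>
    using generate.eng[OF generate.incl[OF singletonI] that[unfolded C4_def]]
    unfolding C4_def sym_group_mult \<sigma>_def .
  have "i = 1 \<or> i = 2 \<or> i = 3 \<or> i = 4" "j = 1 \<or> j = 2 \<or> j = 3 \<or> j = 4"
    using assms by auto
  then have "\<exists>\<pi>\<in>{id, \<sigma> \<circ> id, \<sigma> \<circ> (\<sigma> \<circ> id), \<sigma> \<circ> (\<sigma> \<circ> (\<sigma> \<circ> id))}. \<pi> i = j"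
    by (elim disjE) (simp_all add: simps simps(1)[simplified])
  then show thesis
    using that id comp by blast
qed

section \<open>Vertex potentials and the switching invariant of four vertices\<close>

lemma switch_in_edge_colourings:
  assumes "c \<in> edge_colourings V" "\<pi> \<in> C4"
  shows "switch V v \<pi> c \<in> edge_colourings V"
proof -
  obtain k where "shift_mod4 k \<pi>"
    using C4_shift assms(2) .
  with assms(1) show ?thesis
    unfolding edge_colourings_def switch_def shift_mod4_def PiE_def Pi_def extensional_def by auto
qed

text \<open>A switch at \<open>v\<close> by a shift of \<open>l\<close> adds \<open>l\<close> to the
  potential of \<open>v\<close> alone. The induction carries membership in
  \<open>edge_colourings\<close> along because shifts are controlled only on the colours 1 to
  4.\<close>

lemma switch_equivalent_potential:
  assumes "C4_switch_equivalent V c c'" and c: "c \<in> edge_colourings V"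
  shows "\<exists>k. \<forall>u\<in>V. \<forall>w\<in>V. u \<noteq> w \<longrightarrow> [c' {u, w} = c {u, w} + k u + k w] (mod 4)"
proof -
  have "c' \<in> edge_colourings V \<and>
      (\<exists>k. \<forall>u\<in>V. \<forall>w\<in>V. u \<noteq> w \<longrightarrow> [c' {u, w} = c {u, w} + k u + k w] (mod 4))"
    using assms(1) unfolding C4_switch_equivalent_def
  proof (induction rule: rtranclp_induct)
    case base
    show ?case
      using c by (auto intro!: exI[of _ "\<lambda>_. 0"])
  next
    case (step d d')
    obtain k where k: "\<And>u w. \<lbrakk>u \<in> V; w \<in> V; u \<noteq> w\<rbrakk> \<Longrightarrow> [d {u, w} = c {u, w} + k u + k w] (mod 4)"
      using step.IH by blast
    have d: "d \<in> edge_colourings V"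
      using step.IH by blast
    obtain v \<pi> where v: "v \<in> V" and \<pi>: "\<pi> \<in> C4" and d': "d' = switch V v \<pi> d"
      using step.hyps(2) unfolding C4_switch_step_def by blast
    obtain l where l: "shift_mod4 l \<pi>"
      using C4_shift \<pi> .
    let ?k = "\<lambda>u. if u = v then k u + l else k u"
    have "[d' {u, w} = c {u, w} + ?k u + ?k w] (mod 4)" if uw: "u \<in> V" "w \<in> V" "u \<noteq> w" for u w
    proof -
      have e: "{u, w} \<in> nsets V 2"
        using uw by (simp add: nsets_def)
      then have "d {u, w} \<in> {1..4}"
        using d unfolding edge_colourings_def by blast
      then have "[\<pi> (d {u, w}) = d {u, w} + l] (mod 4)"
        using l unfolding shift_mod4_def by blast
      moreover have "[d {u, w} + l = c {u, w} + k u + k w + l] (mod 4)"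
        using k[OF uw] by (intro cong_add) auto
      ultimately have "[\<pi> (d {u, w}) = c {u, w} + k u + k w + l] (mod 4)"
        by (rule cong_trans)
      then show ?thesis
        using e uw k[OF uw] unfolding d' switch_def by (auto simp: ac_simps)
    qed
    then have "\<exists>k. \<forall>u\<in>V. \<forall>w\<in>V. u \<noteq> w \<longrightarrow> [d' {u, w} = c {u, w} + k u + k w] (mod 4)"
      by (intro exI[of _ ?k] ballI impI)
    moreover have "d' \<in> edge_colourings V"
      unfolding d' using switch_in_edge_colourings[OF d \<pi>] .
    ultimately show ?case
      by (rule conjI[rotated])
  qed
  then show ?thesis ..
qed

text \<open>A perfect matching meets each of the four vertices once, so the potentials contribute
  the same total \<open>?s\<close> to both sums; in \<open>c'\<close> both sums are
  \<open>i + i\<close>.\<close>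

lemma matching_sums_cong:
  assumes equiv: "C4_switch_equivalent V c c'" "c \<in> edge_colourings V"
    and mono: "\<And>e. e \<in> nsets {a, b, x, y} 2 \<Longrightarrow> c' e = i"
    and V: "a \<in> V" "b \<in> V" "x \<in> V" "y \<in> V"
    and dist: "distinct [a, b, x, y]"
  shows "[c {a, b} + c {x, y} = c {a, x} + c {b, y}] (mod 4)"
proof -
  obtain k where k: "\<And>u w. \<lbrakk>u \<in> V; w \<in> V; u \<noteq> w\<rbrakk> \<Longrightarrow> [c' {u, w} = c {u, w} + k u + k w] (mod 4)"
    using switch_equivalent_potential[OF equiv] by blast
  have i: "c' {a, b} = i" "c' {x, y} = i" "c' {a, x} = i" "c' {b, y} = i"
    using dist by (auto intro!: mono simp: nsets_def)
  let ?s = "k a + k b + k x + k y"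
  have "[i + i = (c {a, b} + k a + k b) + (c {x, y} + k x + k y)] (mod 4)"
    using cong_add[OF k[of a b] k[of x y]] dist V i by simp
  moreover have "[i + i = (c {a, x} + k a + k x) + (c {b, y} + k b + k y)] (mod 4)"
    using cong_add[OF k[of a x] k[of b y]] dist V i by simp
  ultimately have "[(c {a, b} + k a + k b) + (c {x, y} + k x + k y)
      = (c {a, x} + k a + k x) + (c {b, y} + k b + k y)] (mod 4)"
    using cong_sym cong_trans by blast
  then have "[(c {a, b} + c {x, y}) + ?s = (c {a, x} + c {b, y}) + ?s] (mod 4)"
    by (simp add: ac_simps)
  then show ?thesis
    by (simp only: cong_add_rcancel_nat)
qed

section \<open>Quartic residues modulo 41\<close>

text \<open>9 is a primitive fourth root of unity modulo 41, and the colour is the logarithm to this base.\<close>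

definition quartic_colour :: "int \<Rightarrow> nat"
  where "quartic_colour x = (let r = x ^ 10 mod 41 in
    if r = 9 then 1 else if r = 40 then 2 else if r = 32 then 3 else 4)"

lemma quartic_colour_range: "quartic_colour x \<in> {1..4}"
  by (simp add: quartic_colour_def Let_def)

lemma nonzero_residue_41:
  fixes x :: int
  assumes "\<not> 41 dvd x"
  shows "x mod 41 \<in> {1..40}"
  using assms by (simp add: dvd_eq_mod_eq_0) (smt (verit) pos_mod_sign pos_mod_bound)

text \<open>Tenth powers of non-zero residues are fourth roots of unity, hence powers of 9; this is
  checked on all 40 residues.\<close>

lemma quartic_colour_cong:
  assumes "\<not> 41 dvd x"
  shows "[9 ^ quartic_colour x = x ^ 10] (mod 41)"
proof -
  have "\<forall>r\<in>{1..40::int}. r ^ 10 mod 41 \<in> {9, 40, 32, 1}"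
    by (simp add: upto.simps flip: set_upto)
  then have "x ^ 10 mod 41 \<in> {9, 40, 32, 1}"
    using nonzero_residue_41[OF assms] by (metis power_mod)
  then show ?thesis
    unfolding quartic_colour_def cong_def by (auto simp: Let_def)
qed

lemma quartic_residues_not_consecutive:
  fixes x :: int
  assumes "[x ^ 10 = 1] (mod 41)"
  shows "\<not> [(x + 1) ^ 10 = 1] (mod 41)"
proof -
  have "\<forall>r\<in>{0..40::int}. r ^ 10 mod 41 = 1 \<longrightarrow> (r + 1) ^ 10 mod 41 \<noteq> 1"
    by (simp add: upto.simps flip: set_upto)
  moreover have "x mod 41 \<in> {0..40}"
    using pos_mod_sign[of 41 x] pos_mod_bound[of 41 x] by simp
  moreover have "(x mod 41 + 1) ^ 10 mod 41 = (x + 1) ^ 10 mod 41"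
    by (metis power_mod mod_add_left_eq)
  ultimately show ?thesis
    using assms power_mod[of x 41 10] unfolding cong_def by auto
qed

text \<open>Dividing by \<open>x\<close> turns \<open>z\<close> and \<open>y\<close> into the
  consecutive residues \<open>z / x\<close> and \<open>z / x + 1\<close>, both with tenth power
  1.\<close>

lemma quartic_residues_sum_free:
  fixes x y z :: int
  assumes "\<not> 41 dvd x" "y = x + z"
    and "[x ^ 10 = y ^ 10] (mod 41)" "[z ^ 10 = x ^ 10] (mod 41)"
  shows False
proof -
  have "coprime x 41"
    using assms(1) prime_imp_coprime[of 41 x] by (simp add: coprime_commute)
  then obtain w where w: "[x * w = 1] (mod 41)"
    using cong_solve_coprime_int by blast
  then have xw: "[(x * w) ^ 10 = 1] (mod 41)"
    using cong_pow[of "x * w" 1 41 10] by simp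
  \<comment> \<open>Here \<open>w\<close> inverts \<open>x\<close> modulo 41, so multiplying by
    \<open>w\<close> divides the tenth power by that of \<open>x\<close>.\<close>
  have scale: "[(t * w) ^ 10 = 1] (mod 41)" if "[t ^ 10 = x ^ 10] (mod 41)" for t
    using cong_trans[OF cong_scalar_right[OF that, of "w ^ 10"]] xw
    by (simp add: power_mult_distrib)
  have "[y * w = z * w + 1] (mod 41)"
    using cong_add[OF cong_refl[of "z * w"] w] assms(2) by (simp add: algebra_simps)
  then have "[(z * w + 1) ^ 10 = (y * w) ^ 10] (mod 41)"
    by (intro cong_pow) (rule cong_sym)
  then have "[(z * w + 1) ^ 10 = 1] (mod 41)"
    using scale[OF cong_sym[OF assms(3)]] cong_trans by blast
  then show False
    using quartic_residues_not_consecutive scale[OF assms(4)] by blast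
qed

lemma power9_cong:
  assumes "[m = n] (mod 4)"
  shows "[(9 :: int) ^ m = 9 ^ n] (mod 41)"
proof -
  have "[(9 :: int) ^ m = 9 ^ (m mod 4)] (mod 41)" for m
  proof -
    have "(9 :: int) ^ m = (9 ^ 4) ^ (m div 4) * 9 ^ (m mod 4)"
      by (simp only: mult_div_mod_eq flip: power_mult power_add)
    moreover have "[(9 ^ 4 :: int) ^ (m div 4) = 1 ^ (m div 4)] (mod 41)"
      by (intro cong_pow) (simp add: cong_def)
    ultimately show ?thesis
      by (metis cong_mult cong_refl mult_1 power_one)
  qed
  from this[of m] this[of n] assms show ?thesis
    unfolding cong_def by simp
qed

section \<open>The bracket colouring of the projective line\<close>

text \<open>A vertex \<open>i < 41\<close> is the point \<open>(i : 1)\<close> of the projective line, the vertex 41 is \<open>(1 : 0)\<close>.\<close>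

definition bracket :: "nat \<Rightarrow> nat \<Rightarrow> int"
  where "bracket i j = (let X = \<lambda>i. if i = 41 then 1 else int i; Y = \<lambda>i. if i = 41 then 0 else 1
    in X i * Y j - X j * Y i)"

lemma bracket_swap: "bracket j i = - bracket i j"
  by (simp add: bracket_def)

text \<open>Three-term Pluecker relation for the 2 by 2 determinants of homogeneous coordinates; its
  three products correspond to the three perfect matchings of \<open>a, b, x, y\<close>.\<close>

lemma bracket_pluecker:
  "bracket a x * bracket b y = bracket a b * bracket x y + bracket a y * bracket b x"
  by (simp add: bracket_def Let_def algebra_simps)

text \<open>The bracket of two finite points is a difference of size at most 40; with the point at
  infinity it is 1 or -1.\<close>

lemma bracket_nonzero:
  assumes "i < 42" "j < 42" "i \<noteq> j"
  shows "\<not> 41 dvd bracket i j"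
proof -
  have "bracket i j \<noteq> 0 \<and> \<bar>bracket i j\<bar> < 41"
    using assms by (auto simp: bracket_def)
  then show ?thesis
    using dvd_imp_le_int by fastforce
qed

text \<open>\<open>Min\<close> and \<open>Max\<close> order the edge because the bracket is
  antisymmetric; the order does not affect the colour, as the exponent 10 is even.\<close>

definition paley_colouring :: "nat set \<Rightarrow> nat"
  where "paley_colouring e = quartic_colour (bracket (Min e) (Max e))"

lemma paley_colouring_cong:
  assumes "i < 42" "j < 42" "i \<noteq> j"
  shows "[9 ^ paley_colouring {i, j} = bracket i j ^ 10] (mod 41)"
proof (cases "i < j")
  case True
  then show ?thesis
    using quartic_colour_cong[OF bracket_nonzero[OF assms]] by (simp add: paley_colouring_def)
next
  case False
  then have "paley_colouring {i, j} = quartic_colour (bracket j i)"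
    using assms(3) by (simp add: paley_colouring_def)
  moreover have "bracket j i ^ 10 = bracket i j ^ 10"
    by (subst bracket_swap) simp
  ultimately show ?thesis
    using quartic_colour_cong[OF bracket_nonzero[of j i]] assms by simp
qed

text \<open>Equal colour sums give the three products of the Pluecker relation the same tenth power,
  which \<open>quartic_residues_sum_free\<close> forbids.\<close>

lemma paley_colouring_no_balanced:
  assumes "a < 42" "b < 42" "x < 42" "y < 42" and dist: "distinct [a, b, x, y]"
    and eq1: "[paley_colouring {a, b} + paley_colouring {x, y}
      = paley_colouring {a, x} + paley_colouring {b, y}] (mod 4)"
    and eq2: "[paley_colouring {a, y} + paley_colouring {b, x}
      = paley_colouring {a, b} + paley_colouring {x, y}] (mod 4)"
  shows False
proof -
  have prod: "[9 ^ (paley_colouring {i, j} + paley_colouring {k, l})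
      = (bracket i j * bracket k l) ^ 10] (mod 41)"
    if "i < 42" "j < 42" "k < 42" "l < 42" "i \<noteq> j" "k \<noteq> l" for i j k l
    unfolding power_add power_mult_distrib
    using that by (intro cong_mult paley_colouring_cong)
  have "[(bracket a b * bracket x y) ^ 10 = (bracket a x * bracket b y) ^ 10] (mod 41)"
    using prod[of a b x y] prod[of a x b y] power9_cong[OF eq1] assms(1-4) dist
    by (auto simp: cong_def)
  moreover have "[(bracket a y * bracket b x) ^ 10 = (bracket a b * bracket x y) ^ 10] (mod 41)"
    using prod[of a b x y] prod[of a y b x] power9_cong[OF eq2] assms(1-4) dist
    by (auto simp: cong_def)
  moreover have "prime (41 :: int)"
    by simp
  then have "\<not> 41 dvd bracket a b * bracket x y"
    using assms(1-4) dist by (auto simp: prime_dvd_mult_iff bracket_nonzero)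
  ultimately show False
    using quartic_residues_sum_free[OF _ bracket_pluecker] cong_sym by blast
qed

text \<open>Restricting the colouring to the first \<open>n\<close> points refutes each
  \<open>n \<le> 42\<close>, so all these values are excluded from the minimum.\<close>

lemma not_C4_arrows_42:
  assumes "n \<le> 42"
  shows "\<not> C4_arrows n [4, 4, 4, 4]"
proof
  assume arrows: "C4_arrows n [4, 4, 4, 4]"
  define c where "c = restrict paley_colouring (nsets {..<n} 2)"
  have c: "c \<in> edge_colourings {..<n}"
    using quartic_colour_range by (auto simp: c_def edge_colourings_def paley_colouring_def)
  then obtain c' i where equiv: "C4_switch_equivalent {..<n} c c'" and "i \<in> {1..4}"
    and "monochromatic {..<n} ([4, 4, 4, 4] ! (i - 1)) 2 c' i"
    using arrows unfolding C4_arrows_def by blast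
  moreover have "[4, 4, 4, 4 :: nat] ! (i - 1) = 4"
    using \<open>i \<in> {1..4}\<close> by (auto simp: nth_Cons' numeral_eq_Suc)
  ultimately obtain H where H: "H \<in> nsets {..<n} 4" "c' ` nsets H 2 \<subseteq> {i}"
    unfolding monochromatic_def by auto
  then obtain a b x y where Heq: "H = {a, b, x, y}" and dist: "distinct [a, b, x, y]"
    by (auto simp: nsets_def card_Suc_eq numeral_eq_Suc)
  have V: "a < n" "b < n" "x < n" "y < n"
    using H(1) by (auto simp: Heq nsets_def)
  have mono: "c' e = i" if "e \<in> nsets {a, b, x, y} 2" for e
    using H(2) that unfolding Heq by blast
  have perm: "{a, y, b, x} = {a, b, x, y}" "{a, b, y, x} = {a, b, x, y}"
    by auto
  have eq1: "[c {a, b} + c {x, y} = c {a, x} + c {b, y}] (mod 4)"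
    using V dist by (intro matching_sums_cong[OF equiv c mono]) auto
  \<comment> \<open>The invariant applied to the order \<open>a, y, b, x\<close> compares the third
    matching with the first.\<close>
  have eq2: "[c {a, y} + c {b, x} = c {a, b} + c {y, x}] (mod 4)"
    using V dist mono by (intro matching_sums_cong[OF equiv c, where i = i]) (auto simp: perm)
  have c_eq: "c {u, w} = paley_colouring {u, w}" if "u < n" "w < n" "u \<noteq> w" for u w
    using that by (simp add: c_def nsets_def)
  show False
  proof (rule paley_colouring_no_balanced)
    show "[paley_colouring {a, b} + paley_colouring {x, y}
      = paley_colouring {a, x} + paley_colouring {b, y}] (mod 4)"
      using eq1 V dist by (simp add: c_eq)
    show "[paley_colouring {a, y} + paley_colouring {b, x}
      = paley_colouring {a, b} + paley_colouring {x, y}] (mod 4)"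
      using eq2 V dist by (simp add: c_eq insert_commute)
  qed (use V assms dist in auto)
qed

section \<open>The upper bound: normalising a star and extending a clique\<close>

text \<open>A switch at \<open>u\<close> changes just one edge of the star at \<open>v\<close>,
  namely \<open>{u, v}\<close>, so the edges can be corrected one after another.\<close>

lemma switch_star_to_colour_1:
  assumes "finite U" "U \<subseteq> V - {v}" "v \<in> V" and c: "c \<in> edge_colourings V"
  shows "\<exists>c'. C4_switch_equivalent V c c' \<and> c' \<in> edge_colourings V \<and> (\<forall>u\<in>U. c' {u, v} = 1)"
  using assms(1,2)
proof (induction rule: finite_induct)
  case empty
  then show ?case
    using c by (auto simp: C4_switch_equivalent_def)
next
  case (insert u U)
  then obtain d where d: "C4_switch_equivalent V c d" "d \<in> edge_colourings V"
    "\<forall>w\<in>U. d {w, v} = 1"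
    by auto
  have u: "u \<in> V" "u \<noteq> v"
    using insert.prems by auto
  have e: "{u, v} \<in> nsets V 2"
    using u \<open>v \<in> V\<close> by (simp add: nsets_def)
  then have "d {u, v} \<in> {1..4}"
    using d(2) unfolding edge_colourings_def by blast
  then obtain \<pi> where \<pi>: "\<pi> \<in> C4" "\<pi> (d {u, v}) = 1"
    using C4_transitive[of "d {u, v}" 1] by auto
  let ?d = "switch V u \<pi> d"
  have "C4_switch_step V d ?d"
    using u(1) \<pi>(1) unfolding C4_switch_step_def by blast
  then have "C4_switch_equivalent V c ?d"
    using d(1) unfolding C4_switch_equivalent_def by simp
  moreover have "?d \<in> edge_colourings V"
    using switch_in_edge_colourings d(2) \<pi>(1) .
  moreover have "?d {w, v} = 1" if "w \<in> insert u U" for w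
    using that d(3) \<pi>(2) e u insert.hyps by (auto simp: switch_def)
  ultimately show ?case
    by blast
qed

text \<open>The star at \<open>n\<close> has one colour, so a single switch there can match it to
  whatever clique \<open>H\<close> is found below \<open>n\<close>, leaving the edges inside
  \<open>H\<close> unchanged.\<close>

lemma C4_arrows_Suc:
  assumes as: "length as = 4" and partn: "partn_lst {..<n} as 2"
  shows "C4_arrows (Suc n) (map Suc as)"
  unfolding C4_arrows_def
proof
  let ?V = "{..<Suc n}"
  fix c assume "c \<in> edge_colourings ?V"
  then have "\<exists>d. C4_switch_equivalent ?V c d \<and> d \<in> edge_colourings ?V \<and> (\<forall>u\<in>{..<n}. d {u, n} = 1)"
    by (intro switch_star_to_colour_1) auto
  then obtain d where d: "C4_switch_equivalent ?V c d" "d \<in> edge_colourings ?V"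
    "\<And>u. u < n \<Longrightarrow> d {u, n} = 1"
    by auto
  have range: "d e \<in> {1..4}" if "e \<in> nsets ?V 2" for e
    using d(2) that unfolding edge_colourings_def by blast
  have sub: "nsets {..<n} 2 \<subseteq> nsets ?V 2"
    by (intro nsets_mono) auto
  \<comment> \<open>Colours of \<open>partn_lst\<close> start at 0. As \<open>d e\<close> is at
    least 1 on edges, the subtraction loses nothing.\<close>
  have "(\<lambda>e. d e - 1) \<in> nsets {..<n} 2 \<rightarrow> {..<length as}"
    using range sub as by fastforce
  then obtain j where j: "j < 4" "monochromatic {..<n} (as ! j) 2 (\<lambda>e. d e - 1) j"
    using partn as unfolding partn_lst_def by metis
  then obtain H where H: "H \<in> nsets {..<n} (as ! j)" "(\<lambda>e. d e - 1) ` nsets H 2 \<subseteq> {j}"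
    unfolding monochromatic_def by blast
  have Hn: "H \<subseteq> {..<n}" "finite H" "card H = as ! j"
    using H(1) by (auto simp: nsets_def)
  have dH: "d e = Suc j" if "e \<in> nsets H 2" for e
  proof -
    have "e \<in> nsets ?V 2"
      using that sub Hn(1) nsets_mono by blast
    moreover have "d e - 1 = j"
      using H(2) that by blast
    ultimately show ?thesis
      using range[of e] by auto
  qed
  obtain \<pi> where \<pi>: "\<pi> \<in> C4" "\<pi> 1 = Suc j"
    using C4_transitive[of 1 "Suc j"] j(1) by auto
  let ?d = "switch ?V n \<pi> d"
  have "C4_switch_step ?V d ?d"
    using \<pi>(1) unfolding C4_switch_step_def by blast
  then have equiv: "C4_switch_equivalent ?V c ?d"
    using d(1) unfolding C4_switch_equivalent_def by simp
  have "?d e = Suc j" if e: "e \<in> nsets (insert n H) 2" for e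
  proof (cases "n \<in> e")
    case True
    obtain u w where "e = {u, w}" "u \<noteq> w" "u \<in> insert n H" "w \<in> insert n H"
      using e by (auto simp: nsets_def card_2_iff)
    with True obtain u where u: "e = {u, n}" "u \<in> H" "u \<noteq> n"
      by (auto simp: insert_commute)
    then have "u < n"
      using Hn(1) by auto
    then show ?thesis
      using u d(3) \<pi>(2) by (simp add: switch_def nsets_def)
  next
    case False
    then have "e \<in> nsets H 2"
      using e by (auto simp: nsets_def)
    with False show ?thesis
      using dH by (simp add: switch_def)
  qed
  moreover have "insert n H \<in> nsets ?V (Suc (as ! j))"
    using Hn by (auto simp: nsets_def card_insert_if)
  ultimately have "monochromatic ?V (map Suc as ! (Suc j - 1)) 2 ?d (Suc j)"
    unfolding monochromatic_def using j(1) as by auto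
  then show "\<exists>c'. C4_switch_equivalent ?V c c' \<and>
      (\<exists>i\<in>{1..4}. monochromatic ?V (map Suc as ! (i - 1)) 2 c' i)"
    using equiv j(1) by (intro exI[of _ ?d] conjI bexI[of _ "Suc j"]) auto
qed

lemma C4_ramsey_number_le:
  assumes "length as = 4"
  shows "C4_ramsey_number (map Suc as) \<le> ramsey_number as + 1"
proof -
  have "partn_lst {..<ramsey_number as} as 2"
    unfolding ramsey_number_def using ex_partn_lst by (rule LeastI_ex)
  then show ?thesis
    unfolding C4_ramsey_number_def using C4_arrows_Suc[OF assms] by (simp add: Least_le)
qed

theorem theorem28:
  shows "43 \<le> C4_ramsey_number [4, 4, 4, 4] \<and>
    C4_ramsey_number [4, 4, 4, 4] \<le> ramsey_number [3, 3, 3, 3] + 1"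
proof
  \<comment> \<open>The minimum is attained because some \<open>n\<close> satisfies the arrow
    relation.\<close>
  have "C4_arrows (C4_ramsey_number [4, 4, 4, 4]) [4, 4, 4, 4]"
    unfolding C4_ramsey_number_def by (rule LeastI_ex, rule ex_C4_arrows) simp
  then show "43 \<le> C4_ramsey_number [4, 4, 4, 4]"
    using not_C4_arrows_42[of "C4_ramsey_number [4, 4, 4, 4]"] by linarith
  show "C4_ramsey_number [4, 4, 4, 4] \<le> ramsey_number [3, 3, 3, 3] + 1"
    using C4_ramsey_number_le[of "[3, 3, 3, 3]"] by simp
qed

end
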